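(* Let $\alpha$ be an irrational number, let $k \geq 1$ and $m \geq 1$ be integers, and let $u$ and $v$ be two factors of length $m$ occurring in a Sturmian word of slope $\alpha$. Then $u \sim_k v$ if and only if there exists an interval $J \in \mathcal{I}_{k,m}$ such that $[u] \subseteq J$ and $[v] \subseteq J$.
   Context: For a real $x$, $\{x\}$ denotes its fractional part. Identify $[0,1)$ with the circle $\mathbb{T}$ and let $R\colon \mathbb{T}\to\mathbb{T}$, $x \mapsto \{x+\alpha\}$. Partition $\mathbb{T}$ into $I_0 = [0,\{1-\alpha\})$, $I_1 = [\{1-\alpha\},1)$ (alternatively $I_0=(0,\{1-\alpha\}]$, $I_1=(\{1-\alpha\},1]$; the choice is fixed and all intervals below use the same half-open convention). The Sturmian word $\mathbf{s}_{x,\alpha}$ of slope $\alpha$ and intercept $x$ is the infinite binary word whose $n$-th letter ($n\ge 0$) is $0$ if $R^n(x)\in I_0$ and $1$ if $R^n(x) \in I_1$. All Sturmian words of slope $\alpha$ have the same set of factors; for such a factor $w$, $[w]$ denotes the subinterval of $\mathbb{T}$ consisting of those $x$ such that $\mathbf{s}_{x,\alpha}$ begins with $w$. For a word $u$ and a nonempty word $w$, $|u|_w$ is the number of occurrences of $w$ as a factor of $u$. Two words $u,v$ are $k$-abelian equivalent, $u\sim_k v$, if $|u|_w = |v|_w$ for every nonempty word $w$ of length at most $k$. Let $\mathcal{D}_{k,m} = \{0, \{-\alpha\}, \{-2\alpha\}, \ldots, \{-\min\{m,k-1\}\alpha\}\}$. If $m \geq k-1$, let $\mathcal{P}_{k,m}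 = \mathcal{D}_{k,m} \cup R^{-(m-(k-1))}(\mathcal{D}_{k,m}) = \mathcal{D}_{k,m}\cup\{\{-(m-(k-1))\alpha\},\ldots,\{-m\alpha\}\}$; otherwise $\mathcal{P}_{k,m}=\mathcal{D}_{k,m}$. Ordering the points of $\mathcal{P}_{k,m}$ as $0=x_0<x_1<\cdots<x_{\ell-1}$ and setting $x_\ell=1$, $\mathcal{I}_{k,m}$ is the set of intervals $[x_i,x_{i+1})$ (or $(x_i,x_{i+1}]$ under the alternative convention), $0\le i<\ell$. *)

theory Defs
  imports Complex_Main "HOL-Library.Omega_Words_Fun"
begin

text \<open>
  The circle is represented by \<open>[0,1)\<close>. The end of an interval that belongs to it is fixed once
  and for all by a value of type \<open>half_open\<close>; every interval is written with real end points
  \<open>0 \<le> a \<le> b \<le> 1\<close> and then projected to the circle by \<^const>\<open>frac\<close>. For \<open>Left_Closed\<close> the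
  projection changes nothing; for \<open>Right_Closed\<close> it identifies the end point \<open>1\<close> of an
  interval \<open>(a,1]\<close> with the point \<open>0\<close>.
\<close>

definition circle :: "real set" where
  "circle = {0..<1}"

datatype half_open = Left_Closed | Right_Closed

definition arc :: "half_open \<Rightarrow> real \<Rightarrow> real \<Rightarrow> real set" where
  "arc c a b = frac ` (case c of Left_Closed \<Rightarrow> {a..<b} | Right_Closed \<Rightarrow> {a<..b})"

definition rotation :: "real \<Rightarrow> real \<Rightarrow> real" where
  "rotation \<alpha> x = frac (x + \<alpha>)"

text \<open>On the circle, the complement of \<open>arc c 0 (frac (1 - \<alpha>))\<close> is \<open>arc c (frac (1 - \<alpha>)) 1\<close>,
  the interval coded by the letter \<open>1\<close>.\<close>

definition sturmian_word :: "half_open \<Rightarrow> real \<Rightarrow> real \<Rightarrow> nat word" where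
  "sturmian_word c \<alpha> x =
     (\<lambda>n. if (rotation \<alpha> ^^ n) x \<in> arc c 0 (frac (1 - \<alpha>)) then 0 else 1)"

definition sturmian_factors :: "half_open \<Rightarrow> real \<Rightarrow> nat list set" where
  "sturmian_factors c \<alpha> =
     {w. \<exists>x\<in>circle. \<exists>i. w = (sturmian_word c \<alpha> x) [i \<rightarrow> i + length w]}"

definition cylinder :: "half_open \<Rightarrow> real \<Rightarrow> nat list \<Rightarrow> real set" where
  "cylinder c \<alpha> w = {x \<in> circle. prefix (length w) (sturmian_word c \<alpha> x) = w}"

definition occurrences :: "'a list \<Rightarrow> 'a list \<Rightarrow> nat" where
  "occurrences u w = card {i. i + length w \<le> length u \<and> take (length w) (drop i u) = w}"

definition k_abelian_equiv :: "nat \<Rightarrow> 'a list \<Rightarrow> 'a list \<Rightarrow> bool" where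
  "k_abelian_equiv k u v \<longleftrightarrow>
     (\<forall>w. w \<noteq> [] \<and> length w \<le> k \<longrightarrow> occurrences u w = occurrences v w)"

definition D_points :: "real \<Rightarrow> nat \<Rightarrow> nat \<Rightarrow> real set" where
  "D_points \<alpha> k m = (\<lambda>j. frac (- real j * \<alpha>)) ` {0..min m (k - 1)}"

definition P_points :: "real \<Rightarrow> nat \<Rightarrow> nat \<Rightarrow> real set" where
  "P_points \<alpha> k m =
     (if m \<ge> k - 1
      then D_points \<alpha> k m \<union>
           {y \<in> circle. (rotation \<alpha> ^^ (m - (k - 1))) y \<in> D_points \<alpha> k m}
      else D_points \<alpha> k m)"

definition I_intervals :: "half_open \<Rightarrow> real \<Rightarrow> nat \<Rightarrow> nat \<Rightarrow> real set set" where
  "I_intervals c \<alpha> k m =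
     (let xs = sorted_list_of_set (P_points \<alpha> k m) @ [1]
      in {arc c (xs ! i) (xs ! Suc i) | i. i < card (P_points \<alpha> k m)})"

end

theory Submission
  imports Defs
begin

text \<open>
  Up to a constant, the number of ones in the prefix of length \<open>j\<close> of the word of intercept \<open>x\<close>
  is \<open>step c x (j\<alpha>)\<close>, which on the circle jumps exactly at \<open>{-j\<alpha>}\<close>. Hence \<open>x\<close> and \<open>y\<close> lie in
  the same interval of \<open>I_intervals c \<alpha> k m\<close> iff their \<open>j\<close>-th prefix sums agree for all
  \<open>j \<in> {0..k-1} \<union> {m-k+1..m}\<close>. If \<open>u\<close> and \<open>v\<close> are \<open>k\<close>-abelian equivalent, they share their
  prefix and suffix of length \<open>k-1\<close> and their number of ones, so these sums agree. Conversely, a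
  cylinder of a word of length \<open>n \<le> k\<close> is an arc with end points \<open>{-a\<alpha>}\<close> and \<open>{-b\<alpha>}\<close>, \<open>a, b \<le> n\<close>,
  so its number of visits by the orbit of \<open>x\<close> is a sum of \<open>step c x ((i+a)\<alpha>) - step c x ((i+b)\<alpha>)\<close>;
  crossing \<open>{-j\<alpha>}\<close> with \<open>k \<le> j \<le> m-k\<close> changes two of these terms and the changes cancel.
\<close>

section \<open>Half-open floors, steps and arcs\<close>

text \<open>\<open>\<lceil>x\<rceil> - 1\<close> is the greatest integer strictly below
  \<open>x\<close>; it is constant on each \<open>(n, n+1]\<close>, as the floor is on each
  \<open>[n, n+1)\<close>.\<close>

definition half_floor :: "half_open \<Rightarrow> real \<Rightarrow> int" where
  "half_floor c x = (case c of Left_Closed \<Rightarrow> \<lfloor>x\<rfloor> | Right_Closed \<Rightarrow> \<lceil>x\<rceil> - 1)"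

text \<open>For \<open>x\<close> on the circle and \<open>p \<in> [0,1]\<close>, \<open>step c x (-p)\<close> is \<open>0\<close> if \<open>x\<close> lies beyond \<open>p\<close>
  and \<open>-1\<close> otherwise, under either convention: subtracting \<open>half_floor c x\<close> moves
  the point \<open>0\<close> to \<open>1\<close> for \<open>Right_Closed\<close>.\<close>

definition step :: "half_open \<Rightarrow> real \<Rightarrow> real \<Rightarrow> int" where
  "step c x t = half_floor c (x + t) - half_floor c x"

lemma half_floor_add_int: "half_floor c (x + of_int n) = half_floor c x + n"
  by (cases c) (auto simp: half_floor_def)

lemma half_floor_mono: "x \<le> y \<Longrightarrow> half_floor c x \<le> half_floor c y"
  using floor_mono[of x y] ceiling_mono[of x y] by (cases c) (auto simp: half_floor_def)

lemma step_0 [simp]: "step c x 0 = 0"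
  by (simp add: step_def)

lemma step_add_int: "step c x (t + of_int n) = step c x t + n"
  by (simp add: step_def half_floor_add_int flip: add.assoc)

lemma step_minus_1 [simp]: "step c x (-1) = -1"
  using step_add_int[of c x 0 "-1"] by simp

lemma step_mono: "s \<le> t \<Longrightarrow> step c x s \<le> step c x t"
  by (simp add: step_def half_floor_mono)

lemma step_cases: "0 \<le> p \<Longrightarrow> p \<le> 1 \<Longrightarrow> step c x (-p) = 0 \<or> step c x (-p) = -1"
  using step_mono[of "-1" "-p" c x] step_mono[of "-p" 0 c x] by auto

text \<open>Cocycle identity along the rotation: reduction modulo 1 subtracts the same integer from
  both values of \<open>half_floor\<close>, so it cancels in their difference.\<close>

lemma step_frac: "step c (frac (x + s)) t = step c x (s + t) - step c x s"
proof -
  have "half_floor c (frac (x + s) + r) = half_floor c (x + s + r) - \<lfloor>x + s\<rfloor>" for r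
    using half_floor_add_int[of c "x + s + r" "- \<lfloor>x + s\<rfloor>"] by (simp add: frac_def algebra_simps)
  from this[of t] this[of 0] show ?thesis
    by (simp add: step_def algebra_simps)
qed

lemma frac_in_circle [simp]: "frac x \<in> circle"
  by (simp add: circle_def frac_lt_1)

text \<open>Translates arcs into steps uniformly in \<open>c\<close>; no later argument
  distinguishes the two conventions.\<close>

lemma mem_arc_iff:
  assumes "0 \<le> a" "a \<le> b" "b \<le> 1"
  shows "x \<in> arc c a b \<longleftrightarrow> x \<in> circle \<and> step c x (-a) = 0 \<and> step c x (-b) = -1"
proof (cases "x \<in> circle")
  case False
  then show ?thesis by (auto simp: arc_def)
next
  case True
  then have x: "0 \<le> x" "x < 1" by (auto simp: circle_def)
  show ?thesis
  proof (cases c)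
    case Left_Closed
    have "x \<in> frac ` {a..<b} \<longleftrightarrow> a \<le> x \<and> x < b"
    proof
      assume "x \<in> frac ` {a..<b}"
      then obtain z where "z \<in> {a..<b}" "x = frac z" by blast
      moreover from this have "frac z = z" using assms by (simp add: frac_eq)
      ultimately show "a \<le> x \<and> x < b" by simp
    next
      assume "a \<le> x \<and> x < b"
      moreover have "frac x = x" using x by (simp add: frac_eq)
      ultimately show "x \<in> frac ` {a..<b}" by (intro image_eqI[of _ _ x]) auto
    qed
    moreover have "\<lfloor>x\<rfloor> = 0" using x by linarith
    moreover have "\<lfloor>x - a\<rfloor> = 0 \<longleftrightarrow> a \<le> x" using x assms by linarith
    moreover have "\<lfloor>x - b\<rfloor> = -1 \<longleftrightarrow> x < b" using x assms by linarith
    ultimately show ?thesis using True Left_Closed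
      by (simp add: arc_def step_def half_floor_def)
  next
    case Right_Closed
    \<comment> \<open>The representative of \<open>x\<close> in \<open>(0,1]\<close>, where
      right-closed arcs live before \<open>frac\<close> is applied.\<close>
    define x' where "x' = (if x = 0 then 1 else x)"
    have x': "0 < x'" "x' \<le> 1" "frac x' = x" using x by (auto simp: x'_def frac_eq)
    have "x \<in> frac ` {a<..b} \<longleftrightarrow> a < x' \<and> x' \<le> b"
    proof
      assume "x \<in> frac ` {a<..b}"
      then obtain z where z: "z \<in> {a<..b}" "x = frac z" by blast
      have "z = x'"
      proof (cases "z = 1")
        case True
        then show ?thesis using z by (simp add: x'_def)
      next
        case False
        then have "frac z = z" using z assms by (simp add: frac_eq)
        then show ?thesis using z assms by (simp add: x'_def)
      qed
      then show "a < x' \<and> x' \<le> b" using z by simp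
    next
      assume "a < x' \<and> x' \<le> b"
      then show "x \<in> frac ` {a<..b}" using x' by (intro image_eqI[of _ _ x']) auto
    qed
    moreover have "\<lceil>x - a\<rceil> - \<lceil>x\<rceil> = \<lceil>x' - a\<rceil> - 1" "\<lceil>x - b\<rceil> - \<lceil>x\<rceil> = \<lceil>x' - b\<rceil> - 1"
    proof -
      \<comment> \<open>On the circle \<open>\<lceil>x\<rceil>\<close> is 0 at the point 0 and 1
        elsewhere, so \<open>x'\<close> is \<open>x + 1 - \<lceil>x\<rceil>\<close>, an integer
        translate of \<open>x\<close>.\<close>
      have "\<lceil>x' - t\<rceil> = \<lceil>x - t\<rceil> + 1 - \<lceil>x\<rceil>" for t
      proof (cases "x = 0")
        case True
        then show ?thesis using ceiling_add_of_int[of "- t" 1] by (simp add: x'_def algebra_simps)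
      next
        case False
        then have "\<lceil>x\<rceil> = 1" using x by linarith
        then show ?thesis using False by (simp add: x'_def)
      qed
      then show "\<lceil>x - a\<rceil> - \<lceil>x\<rceil> = \<lceil>x' - a\<rceil> - 1" "\<lceil>x - b\<rceil> - \<lceil>x\<rceil> = \<lceil>x' - b\<rceil> - 1" by simp_all
    qed
    moreover have "\<lceil>x' - a\<rceil> = 1 \<longleftrightarrow> a < x'" using x' assms by linarith
    moreover have "\<lceil>x' - b\<rceil> = 0 \<longleftrightarrow> x' \<le> b" using x' assms by linarith
    ultimately show ?thesis using True Right_Closed
      by (simp add: arc_def step_def half_floor_def)
  qed
qed

section \<open>Orbits, letters and cylinders\<close>

lemma rotation_funpow:
  assumes "x \<in> circle"
  shows "(rotation \<alpha> ^^ n) x = frac (x + real n * \<alpha>)"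
proof (induction n)
  case 0
  then show ?case using assms by (simp add: circle_def frac_eq)
next
  case (Suc n)
  have "frac (frac (x + real n * \<alpha>) + \<alpha>) = frac (x + real n * \<alpha> + \<alpha>)"
    by (metis frac_def frac_1_eq add.commute frac_add_simps(1))
  then show ?case using Suc by (simp add: rotation_def algebra_simps)
qed

text \<open>The end point \<open>frac (1 - \<alpha>)\<close> of the arc of the letter 0 is congruent
  to \<open>- \<alpha>\<close> modulo 1, so a letter is a step by \<open>\<alpha>\<close> at the
  orbit point; \<open>step_frac\<close> carries it back to \<open>x\<close>.\<close>

lemma sturmian_letter:
  assumes "x \<in> circle" "\<alpha> \<notin> \<int>"
  shows "int (sturmian_word c \<alpha> x n) =
    step c x (real (Suc n) * \<alpha>) - step c x (real n * \<alpha>) - \<lfloor>\<alpha>\<rfloor>"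
proof -
  define z where "z = frac (x + real n * \<alpha>)"
  have f: "frac (1 - \<alpha>) = 1 - frac \<alpha>"
    using frac_neg[of \<alpha>] frac_1_eq[of "- \<alpha>"] assms(2) by simp
  have "- frac (1 - \<alpha>) = \<alpha> + of_int (- \<lfloor>\<alpha>\<rfloor> - 1)"
    unfolding f by (simp add: frac_def)
  then have "step c z (- frac (1 - \<alpha>)) = step c z (\<alpha> + of_int (- \<lfloor>\<alpha>\<rfloor> - 1))"
    by (rule arg_cong)
  also have "\<dots> = step c z \<alpha> - \<lfloor>\<alpha>\<rfloor> - 1"
    by (subst step_add_int) simp
  also have "step c z \<alpha> = step c x (real (Suc n) * \<alpha>) - step c x (real n * \<alpha>)"
    unfolding z_def step_frac by (simp add: algebra_simps)
  finally have e: "step c z (- frac (1 - \<alpha>)) = \<dots> - \<lfloor>\<alpha>\<rfloor> - 1" .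
  have "0 \<le> frac (1 - \<alpha>)" "frac (1 - \<alpha>) \<le> 1"
    by (auto simp: less_imp_le[OF frac_lt_1])
  note step_cases[OF this, of c z] mem_arc_iff[OF order_refl this, of z c]
  moreover have "z \<in> circle" by (simp add: z_def)
  ultimately show ?thesis
    using e assms(1) by (auto simp: sturmian_word_def rotation_funpow z_def[symmetric])
qed

lemma sturmian_shift:
  assumes "x \<in> circle"
  shows "sturmian_word c \<alpha> (frac (x + real i * \<alpha>)) n = sturmian_word c \<alpha> x (i + n)"
proof -
  have "(rotation \<alpha> ^^ n) ((rotation \<alpha> ^^ i) x) = (rotation \<alpha> ^^ (i + n)) x"
    by (metis add.commute comp_apply funpow_add)
  then show ?thesis
    using rotation_funpow[OF assms] by (simp add: sturmian_word_def)
qed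

lemma mem_cylinder_iff:
  "x \<in> cylinder c \<alpha> w \<longleftrightarrow> x \<in> circle \<and> (\<forall>i<length w. w ! i = sturmian_word c \<alpha> x i)"
proof -
  have "prefix (length w) (sturmian_word c \<alpha> x) = w \<longleftrightarrow>
      (\<forall>i<length w. sturmian_word c \<alpha> x i = w ! i)"
    unfolding list_eq_iff_nth_eq[of "prefix _ _"] by simp
  then show ?thesis unfolding cylinder_def mem_Collect_eq by metis
qed

text \<open>A factor read at position \<open>i\<close> is a prefix of the word of the
  \<open>i\<close>-th orbit point.\<close>

lemma cylinder_nonempty:
  assumes "u \<in> sturmian_factors c \<alpha>"
  obtains x where "x \<in> cylinder c \<alpha> u"
proof -
  from assms obtain x i where x: "x \<in> circle" "u = (sturmian_word c \<alpha> x) [i \<rightarrow> i + length u]"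
    by (auto simp: sturmian_factors_def)
  have "u ! j = sturmian_word c \<alpha> x (i + j)" if "j < length u" for j
    by (subst x(2)) (use that in simp)
  then have "frac (x + real i * \<alpha>) \<in> cylinder c \<alpha> u"
    using x(1) by (simp add: mem_cylinder_iff sturmian_shift)
  then show thesis by (rule that)
qed

text \<open>The formula for single letters telescopes. In particular, all points of a cylinder have
  the same steps up to the length of the word; \<open>cylinder_eqI\<close> is the converse.\<close>

lemma sum_list_take_eq_step:
  assumes "x \<in> cylinder c \<alpha> u" "\<alpha> \<notin> \<int>" "j \<le> length u"
  shows "int (sum_list (take j u)) = step c x (real j * \<alpha>) - int j * \<lfloor>\<alpha>\<rfloor>"
  using assms(3)
proof (induction j)
  case (Suc j)
  have "int (u ! j) = step c x (real (Suc j) * \<alpha>) - step c x (real j * \<alpha>) - \<lfloor>\<alpha>\<rfloor>"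
    using sturmian_letter[of x \<alpha> c j] Suc.prems assms by (simp add: mem_cylinder_iff)
  then show ?case using Suc by (simp add: take_Suc_conv_app_nth algebra_simps)
qed simp

lemma cylinder_eqI:
  assumes "x \<in> cylinder c \<alpha> w" "y \<in> circle" "\<alpha> \<notin> \<int>"
    and "\<And>j. j \<le> length w \<Longrightarrow> step c x (real j * \<alpha>) = step c y (real j * \<alpha>)"
  shows "y \<in> cylinder c \<alpha> w"
proof -
  have "sturmian_word c \<alpha> x i = sturmian_word c \<alpha> y i" if "i < length w" for i
  proof -
    have "int (sturmian_word c \<alpha> x i) = int (sturmian_word c \<alpha> y i)"
      using sturmian_letter[of x \<alpha> c i] sturmian_letter[of y \<alpha> c i] assms that
        assms(4)[of i] assms(4)[of "Suc i"] by (simp add: mem_cylinder_iff)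
    then show ?thesis by simp
  qed
  then show ?thesis using assms by (simp add: mem_cylinder_iff)
qed

text \<open>The offset does not depend on \<open>x\<close>: comparing two points at a division point
  of the circle amounts to comparing their steps at \<open>real j * \<alpha>\<close>.\<close>

lemma step_frac_minus:
  "step c x (- frac (- real j * \<alpha>)) = step c x (real j * \<alpha>) + \<lfloor>- real j * \<alpha>\<rfloor>"
proof -
  have "- frac (- real j * \<alpha>) = real j * \<alpha> + of_int \<lfloor>- real j * \<alpha>\<rfloor>"
    by (simp add: frac_def)
  then show ?thesis by (simp only: step_add_int)
qed

section \<open>Occurrences as visits of the orbit to an arc\<close>

text \<open>The points \<open>frac (- real j * \<alpha>)\<close> with
  \<open>j \<le> length w\<close> cut the circle into arcs, and the cylinder is the arc containing
  \<open>x\<close>. Its indicator is the difference of the steps at its two ends; \<open>C\<close>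
  absorbs the integer offsets.\<close>

lemma cylinder_indicator:
  assumes "\<alpha> \<notin> \<int>" "x \<in> cylinder c \<alpha> w"
  obtains a b :: nat and C :: int where "a \<le> length w" "b \<le> length w"
    "\<And>y. y \<in> circle \<Longrightarrow>
      of_bool (y \<in> cylinder c \<alpha> w) = step c y (real a * \<alpha>) - step c y (real b * \<alpha>) + C"
proof -
  define p where "p j = frac (- real j * \<alpha>)" for j
  have p: "0 \<le> p j" "p j \<le> 1" for j
    by (auto simp: p_def less_imp_le[OF frac_lt_1])
  define E where "E = p ` {..length w}"
  \<comment> \<open>\<open>A\<close> holds the division points that \<open>x\<close> has passed and
    \<open>B\<close> those still ahead, closed off by 1; \<open>Max A\<close> and
    \<open>Min B\<close> are the ends of the arc around \<open>x\<close>.\<close>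
  define A where "A = {q \<in> E. step c x (-q) = 0}"
  define B where "B = insert 1 {q \<in> E. step c x (-q) = -1}"
  have fin: "finite A" "finite B" by (auto simp: A_def B_def E_def)
  have "p 0 \<in> A" by (auto simp: A_def E_def p_def image_iff intro!: bexI[of _ 0])
  then have MA: "Max A \<in> A" using fin by (intro Max_in) auto
  have MB: "Min B \<in> B" using fin by (intro Min_in) (auto simp: B_def)
  obtain a where a: "a \<le> length w" "Max A = p a" using MA by (auto simp: A_def E_def)
  have "\<exists>b\<le>length w. \<exists>C. \<forall>y. step c y (- Min B) = step c y (real b * \<alpha>) + C"
  proof (cases "Min B = 1")
    case True
    \<comment> \<open>The end 1 is the point 0 after a full turn, hence index 0 with offset
      -1.\<close>
    then show ?thesis by (intro exI[of _ 0] conjI exI[of _ "-1"]) auto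
  next
    case False
    then obtain b where "b \<le> length w" "Min B = p b" using MB by (auto simp: B_def E_def)
    then show ?thesis by (auto simp only: p_def step_frac_minus intro!: exI[of _ b])
  qed
  then obtain b C where b: "b \<le> length w" "\<And>y. step c y (- Min B) = step c y (real b * \<alpha>) + C"
    by auto
  have mem: "y \<in> cylinder c \<alpha> w \<longleftrightarrow> step c y (- Max A) = 0 \<and> step c y (- Min B) = -1"
    if y: "y \<in> circle" for y
  proof
    assume "y \<in> cylinder c \<alpha> w"
    then have "step c y (real j * \<alpha>) = step c x (real j * \<alpha>)" if "j \<le> length w" for j
      using sum_list_take_eq_step[of _ c \<alpha> w j] assms that by (metis diff_add_cancel)
    then have "step c y (-q) = step c x (-q)" if "q \<in> E" for q
      using that by (auto simp only: E_def p_def step_frac_minus)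
    then show "step c y (- Max A) = 0 \<and> step c y (- Min B) = -1"
      using MA MB by (auto simp: A_def B_def)
  next
    assume s: "step c y (- Max A) = 0 \<and> step c y (- Min B) = -1"
    \<comment> \<open>By monotonicity, having passed \<open>Max A\<close> means having passed all of
      \<open>A\<close>, and not having passed \<open>Min B\<close> excludes all of
      \<open>B\<close>.\<close>
    have "step c x (- p j) = step c y (- p j)" if j: "j \<le> length w" for j
    proof (cases "step c x (- p j) = 0")
      case True
      then have "p j \<in> A" using j by (auto simp: A_def E_def)
      then have "- Max A \<le> - p j" using fin by auto
      then show ?thesis
        using step_mono[of "- Max A" "- p j" c y] step_cases[OF p, of c y j] s True by auto
    next
      case False
      then have *: "step c x (- p j) = -1" using step_cases[OF p] by blast
      then have "p j \<in> B" using j by (auto simp: B_def E_def)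
      then have "- p j \<le> - Min B" using fin by auto
      then show ?thesis
        using step_mono[of "- p j" "- Min B" c y] step_cases[OF p, of c y j] s * by auto
    qed
    then have "step c x (real j * \<alpha>) = step c y (real j * \<alpha>)" if "j \<le> length w" for j
      using that by (simp add: p_def step_frac_minus[simplified])
    then show "y \<in> cylinder c \<alpha> w"
      using cylinder_eqI[OF assms(2) y assms(1)] by blast
  qed
  \<comment> \<open>With the ends in this order no point has step -1 at \<open>Max A\<close> and 0
    at \<open>Min B\<close>, the one case where the difference of steps would be -1.\<close>
  have le: "Max A \<le> Min B"
  proof (rule ccontr)
    assume "\<not> Max A \<le> Min B"
    then have "step c x (- Max A) \<le> step c x (- Min B)" by (intro step_mono) simp
    moreover have "step c x (- Max A) = 0" using MA by (simp add: A_def)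
    moreover have "step c x (- Min B) = -1" using MB by (auto simp: B_def)
    ultimately show False by simp
  qed
  have 1: "of_bool (y \<in> cylinder c \<alpha> w) = step c y (- Max A) - step c y (- Min B)"
    if y: "y \<in> circle" for y
  proof -
    have "0 \<le> Min B" "Min B \<le> 1" using MB p fin by (auto simp: B_def E_def)
    then show ?thesis
      using mem[OF y] step_cases[of "Max A" c y] step_cases[of "Min B" c y] p[of a] a
        step_mono[of "- Min B" "- Max A" c y] le
      by auto
  qed
  show thesis
  proof (rule that[OF a(1) b(1)])
    fix y assume "y \<in> circle"
    from 1[OF this] show "of_bool (y \<in> cylinder c \<alpha> w) =
        step c y (real a * \<alpha>) - step c y (real b * \<alpha>) + (\<lfloor>- real a * \<alpha>\<rfloor> - C)"
      by (simp only: a(2) b(2) p_def step_frac_minus)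
  qed
qed

lemma occurrences_cylinder:
  assumes "x \<in> cylinder c \<alpha> u" "length w \<le> length u"
  shows "int (occurrences u w) =
    (\<Sum>i\<le>length u - length w. of_bool (frac (x + real i * \<alpha>) \<in> cylinder c \<alpha> w))"
proof -
  have "{i. i + length w \<le> length u \<and> take (length w) (drop i u) = w} =
      {..length u - length w} \<inter> {i. frac (x + real i * \<alpha>) \<in> cylinder c \<alpha> w}"
    using assms by (auto simp: mem_cylinder_iff sturmian_shift list_eq_iff_nth_eq)
  then show ?thesis
    by (simp only: occurrences_def sum_of_bool_eq finite_atMost)
qed

text \<open>The difference \<open>d\<close> between the steps of \<open>x\<close> and
  \<open>y\<close> vanishes near both ends of \<open>{..m}\<close>. Hence its sum over a window of
  \<open>m - n + 1\<close> indices starting at any \<open>a \<le> n\<close> equals its sum over all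
  of \<open>{..m}\<close>, and the contributions of the two ends of the arc cancel.\<close>

lemma occurrences_eq:
  assumes "\<alpha> \<notin> \<int>" "x \<in> cylinder c \<alpha> u" "y \<in> cylinder c \<alpha> v"
    and len: "length u = m" "length v = m" "length w \<le> k"
    and agree: "\<And>j. j \<le> m \<Longrightarrow> j < k \<or> m < j + k \<Longrightarrow>
      step c x (real j * \<alpha>) = step c y (real j * \<alpha>)"
  shows "occurrences u w = occurrences v w"
\<comment> \<open>A word that is too long, or whose cylinder is empty, has no occurrences; otherwise
  a point of the cylinder is available for \<open>cylinder_indicator\<close>.\<close>
proof (cases "length w \<le> m \<and> cylinder c \<alpha> w \<noteq> {}")
  case False
  show ?thesis
  proof (cases "length w \<le> m")
    case True
    with False have "cylinder c \<alpha> w = {}" by simp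
    then have "int (occurrences u w) = 0" "int (occurrences v w) = 0"
      using occurrences_cylinder[of x c \<alpha> u w] occurrences_cylinder[of y c \<alpha> v w] assms True
      by simp_all
    then show ?thesis by simp
  next
    case False
    then show ?thesis using len by (simp add: occurrences_def)
  qed
next
  case True
  define n where "n = length w"
  have n: "n \<le> m" "n \<le> k" using True len by (auto simp: n_def)
  from True obtain z where "z \<in> cylinder c \<alpha> w" by blast
  from cylinder_indicator[OF assms(1) this] obtain a b C
    where ab: "a \<le> n" "b \<le> n" and ind: "\<And>y. y \<in> circle \<Longrightarrow>
      of_bool (y \<in> cylinder c \<alpha> w) = step c y (real a * \<alpha>) - step c y (real b * \<alpha>) + C"
    unfolding n_def by metis
  have occ: "int (occurrences u w) = (\<Sum>i\<le>m-n. step c x (real (i + a) * \<alpha>))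
      - (\<Sum>i\<le>m-n. step c x (real (i + b) * \<alpha>)) + int (Suc (m - n)) * C"
    if "x \<in> cylinder c \<alpha> u" "length u = m" for x u
  proof -
    have "int (occurrences u w) =
        (\<Sum>i\<le>m-n. of_bool (frac (x + real i * \<alpha>) \<in> cylinder c \<alpha> w))"
      using occurrences_cylinder[OF that(1), of w] that n by (simp add: n_def)
    also have "\<dots> = (\<Sum>i\<le>m-n. step c x (real (i + a) * \<alpha>) - step c x (real (i + b) * \<alpha>) + C)"
      by (intro sum.cong refl) (simp add: ind step_frac algebra_simps)
    finally show ?thesis by (simp add: sum.distrib sum_subtractf)
  qed
  define d where "d j = step c x (real j * \<alpha>) - step c y (real j * \<alpha>)" for j
  have d: "(\<Sum>i\<le>m-n. d (i + a)) = (\<Sum>j\<le>m. d j)" if "a \<le> n" for a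
  proof -
    have "(\<Sum>i\<le>m-n. d (i + a)) = sum d {a..m-n+a}"
      by (rule sum.reindex_bij_witness[of _ "\<lambda>j. j - a" "\<lambda>i. i + a"]) (use that in auto)
    also have "\<dots> = (\<Sum>j\<le>m. d j)"
    proof (rule sum.mono_neutral_left)
      show "\<forall>j\<in>{..m} - {a..m-n+a}. d j = 0"
      proof
        fix j assume "j \<in> {..m} - {a..m-n+a}"
        \<comment> \<open>Left of the window \<open>j < a \<le> n \<le> k\<close>; right of it
          \<open>j > m - n + a\<close>, which is at least \<open>m - k\<close>.\<close>
        then have "j \<le> m" "j < k \<or> m < j + k" using that n by auto
        then show "d j = 0" using agree by (simp add: d_def)
      qed
    qed (use that n in auto)
    finally show ?thesis .
  qed
  have "(\<Sum>i\<le>m-n. d (i + a)) = (\<Sum>i\<le>m-n. d (i + b))" using d ab by simp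
  then have "int (occurrences u w) = int (occurrences v w)"
    using occ[of x u] occ[of y v] assms by (simp add: d_def sum_subtractf)
  then show ?thesis by simp
qed

section \<open>Common prefixes and suffixes of equivalent words\<close>

text \<open>Every occurrence of \<open>w\<close> is followed by exactly one letter, except the one
  that ends the word.\<close>

lemma occurrences_snoc_sum:
  assumes "finite S" "set u \<subseteq> S" "length w \<le> length u"
  shows "occurrences u w =
    (\<Sum>a\<in>S. occurrences u (w @ [a])) + of_bool (drop (length u - length w) u = w)"
proof -
  define n m where "n = length w" and "m = length u"
  have nm: "n \<le> m" using assms by (simp add: n_def m_def)
  define X where "X a = {i. i + Suc n \<le> m \<and> take (Suc n) (drop i u) = w @ [a]}" for a
  have X: "X a = {i. i + n < m \<and> take n (drop i u) = w \<and> u ! (i + n) = a}" for a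
    by (auto simp: X_def n_def m_def take_Suc_conv_app_nth)
  have fin: "finite (X a)" for a
    by (rule finite_subset[of _ "{..m}"]) (auto simp: X)
  have "{i. i + n \<le> m \<and> take n (drop i u) = w} =
      (\<Union>a\<in>S. X a) \<union> {i. i = m - n \<and> drop i u = w}" (is "?L = ?R")
  proof (rule set_eqI)
    fix i
    consider "i + n < m" | "i = m - n" | "i + n > m" by linarith
    then show "i \<in> ?L \<longleftrightarrow> i \<in> ?R"
    proof cases
      case 1
      then have "u ! (i + n) \<in> S" using assms(2) by (auto simp: m_def)
      then show ?thesis using 1 by (auto simp: X)
    qed (use nm in \<open>auto simp: X n_def m_def\<close>)
  qed
  moreover have "card ((\<Union>a\<in>S. X a) \<union> {i. i = m - n \<and> drop i u = w}) =
      card (\<Union>a\<in>S. X a) + card {i. i = m - n \<and> drop i u = w}"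
    by (rule card_Un_disjoint) (use fin assms nm in \<open>auto simp: X\<close>)
  moreover have "card (\<Union>a\<in>S. X a) = (\<Sum>a\<in>S. card (X a))"
    by (rule card_UN_disjoint) (use fin assms in \<open>auto simp: X\<close>)
  moreover have "card {i. i = m - n \<and> drop i u = w} = of_bool (drop (m - n) u = w)"
    by (cases "drop (m - n) u = w") (auto simp: conj_commute cong: conj_cong)
  ultimately show ?thesis
    by (simp add: occurrences_def X_def n_def m_def)
qed

text \<open>Reversal moves an occurrence from position \<open>i\<close> to \<open>m - n - i\<close>.
  This yields the prefix result from the suffix result.\<close>

lemma occurrences_rev: "occurrences (rev u) (rev w) = occurrences u w"
proof -
  define n m where "n = length w" and "m = length u"
  have rev: "take n (drop i (rev u)) = rev (take n (drop (m - (n + i)) u))" if "i + n \<le> m" for i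
  proof -
    have "take n (drop i (rev u)) = rev (drop (m - i - n) (take (m - i) u))"
      using that by (cases "i = 0") (auto simp: drop_rev take_rev m_def n_def min_def)
    also have "drop (m - i - n) (take (m - i) u) = take n (drop (m - (n + i)) u)"
      using that by (simp add: drop_take add.commute)
    finally show ?thesis .
  qed
  have rev': "take n (drop (m - (n + i)) (rev u)) = rev (take n (drop i u))" if "i + n \<le> m" for i
    using rev[of "m - (n + i)"] that by simp
  have "bij_betw (\<lambda>i. m - n - i) {i. i + n \<le> m \<and> take n (drop i (rev u)) = rev w}
      {i. i + n \<le> m \<and> take n (drop i u) = w}"
    by (rule bij_betw_byWitness[of _ "\<lambda>i. m - n - i"]) (auto simp: rev rev')
  then show ?thesis
    by (simp add: occurrences_def n_def m_def bij_betw_same_card)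
qed

lemma k_abelian_equiv_rev:
  fixes u v :: "'a list"
  shows "k_abelian_equiv k u v \<Longrightarrow> k_abelian_equiv k (rev u) (rev v)"
  unfolding k_abelian_equiv_def
proof (intro allI impI)
  fix w :: "'a list" assume "\<forall>w. w \<noteq> [] \<and> length w \<le> k \<longrightarrow> occurrences u w = occurrences v w"
    and "w \<noteq> [] \<and> length w \<le> k"
  then have "occurrences u (rev w) = occurrences v (rev w)" by simp
  then show "occurrences (rev u) w = occurrences (rev v) w"
    using occurrences_rev[of u "rev w"] occurrences_rev[of v "rev w"] by simp
qed

text \<open>By \<open>occurrences_snoc_sum\<close>, the counts for lengths \<open>n\<close> and
  \<open>n + 1\<close> decide whether a given word is the suffix; \<open>n < k\<close> keeps both
  lengths within \<open>k\<close>.\<close>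

lemma k_abelian_equiv_suffix:
  assumes "k_abelian_equiv k u v" "length u = length v" "n < k" "n \<le> length u"
  shows "drop (length u - n) u = drop (length u - n) v"
\<comment> \<open>Equivalence says nothing about the empty word.\<close>
proof (cases "n = 0")
  case True
  then show ?thesis using assms by simp
next
  case False
  define w where "w = drop (length u - n) u"
  have w: "length w = n" using assms by (simp add: w_def)
  have "occurrences u w = occurrences v w"
    using assms w False by (auto simp: k_abelian_equiv_def)
  moreover have "occurrences u (w @ [a]) = occurrences v (w @ [a])" for a
    using assms w by (auto simp: k_abelian_equiv_def)
  ultimately have "of_bool (drop (length u - n) u = w) = (of_bool (drop (length u - n) v = w) :: nat)"
    using occurrences_snoc_sum[of "set u \<union> set v" u w] occurrences_snoc_sum[of "set u \<union> set v" v w]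
      assms w by simp
  then show ?thesis by (cases "drop (length u - n) v = w") (simp_all add: w_def)
qed

lemma k_abelian_equiv_prefix:
  assumes "k_abelian_equiv k u v" "length u = length v" "n < k" "n \<le> length u"
  shows "take n u = take n v"
  using k_abelian_equiv_suffix[OF k_abelian_equiv_rev[OF assms(1)], of n] assms
  by (simp add: drop_rev)

section \<open>Equivalence as agreement of prefix sums\<close>

lemma sum_list_eq_occurrences:
  assumes "set u \<subseteq> {0, 1 :: nat}"
  shows "sum_list u = occurrences u [1]"
proof -
  have "sum_list u = (\<Sum>i<length u. u ! i)"
    by (simp add: sum_list_sum_nth atLeast0LessThan)
  also have "\<dots> = (\<Sum>i<length u. of_bool (u ! i = 1))"
    using assms by (intro sum.cong) (auto dest!: nth_mem)
  also have "\<dots> = card {i. i < length u \<and> u ! i = 1}"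
    by (simp add: of_bool_def sum.If_cases Collect_conj_eq lessThan_def)
  also have "{i. i < length u \<and> u ! i = 1} = {i. i + length [1::nat] \<le> length u \<and>
      take (length [1::nat]) (drop i u) = [1]}"
    by (auto simp: take_Suc_conv_app_nth)
  finally show ?thesis by (simp add: occurrences_def)
qed

lemma cylinder_letters: "x \<in> cylinder c \<alpha> u \<Longrightarrow> set u \<subseteq> {0, 1}"
proof
  fix a assume "x \<in> cylinder c \<alpha> u" "a \<in> set u"
  then obtain i where "a = sturmian_word c \<alpha> x i"
    unfolding mem_cylinder_iff in_set_conv_nth by metis
  then show "a \<in> {0, 1}" by (simp add: sturmian_word_def)
qed

lemma k_abelian_equiv_iff_step:
  assumes "\<alpha> \<notin> \<int>" "x \<in> cylinder c \<alpha> u" "y \<in> cylinder c \<alpha> v"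
    and len: "length u = m" "length v = m" and "k \<ge> 1"
  shows "k_abelian_equiv k u v \<longleftrightarrow> (\<forall>j\<le>m. j < k \<or> m < j + k \<longrightarrow>
      step c x (real j * \<alpha>) = step c y (real j * \<alpha>))"
proof
  assume "\<forall>j\<le>m. j < k \<or> m < j + k \<longrightarrow> step c x (real j * \<alpha>) = step c y (real j * \<alpha>)"
  then show "k_abelian_equiv k u v"
    unfolding k_abelian_equiv_def using occurrences_eq[OF assms(1-3) len] by blast
next
  assume equiv: "k_abelian_equiv k u v"
  have "occurrences u [1] = occurrences v [1]"
    using equiv \<open>k \<ge> 1\<close> unfolding k_abelian_equiv_def by simp
  then have total: "sum_list u = sum_list v"
    by (simp only: assms(2,3)[THEN cylinder_letters, THEN sum_list_eq_occurrences])
  show "\<forall>j\<le>m. j < k \<or> m < j + k \<longrightarrow> step c x (real j * \<alpha>) = step c y (real j * \<alpha>)"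
  proof (intro allI impI)
    fix j assume j: "j \<le> m" "j < k \<or> m < j + k"
    have "sum_list (take j u) = sum_list (take j v)"
    proof (cases "j < k")
      case True
      then show ?thesis using k_abelian_equiv_prefix[OF equiv, of j] len j by simp
    next
      case False
      then have "m - j < k" using j by auto
      \<comment> \<open>Removing the common suffix of length \<open>m - j\<close> from the equal
        totals leaves equal prefix sums.\<close>
      then have "drop j u = drop j v"
        using k_abelian_equiv_suffix[OF equiv, of "m - j"] len j by simp
      then show ?thesis
        using total by (metis append_take_drop_id sum_list_append add_right_cancel)
    qed
    then show "step c x (real j * \<alpha>) = step c y (real j * \<alpha>)"
      using sum_list_take_eq_step[of x c \<alpha> u j] sum_list_take_eq_step[of y c \<alpha> v j] assms j
      by simp
  qed
qed

section \<open>Division points and their intervals\<close>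

text \<open>Pulling back by \<open>r = m - (k - 1)\<close> rotations shifts the indices
  \<open>{0..k-1}\<close> to \<open>{r..m}\<close>. The resulting index set is the one in
  \<open>k_abelian_equiv_iff_step\<close>.\<close>

lemma P_points_eq:
  assumes "k \<ge> 1"
  shows "P_points \<alpha> k m = (\<lambda>j. frac (- real j * \<alpha>)) ` {j. j \<le> m \<and> (j < k \<or> m < j + k)}"
proof (cases "m \<ge> k - 1")
  case True
  define r where "r = m - (k - 1)"
  have "{y \<in> circle. (rotation \<alpha> ^^ r) y \<in> D_points \<alpha> k m} =
      (\<lambda>j. frac (- real j * \<alpha>)) ` {r..m}" (is "?L = ?R")
  proof (intro equalityI subsetI)
    fix y assume "y \<in> ?L"
    then obtain j where y: "y \<in> circle" "j \<le> k - 1" "frac (y + real r * \<alpha>) = frac (- real j * \<alpha>)"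
      using True by (auto simp: rotation_funpow D_points_def)
    from y(3) have "- real (r + j) * \<alpha> - y = of_int (\<lfloor>- real j * \<alpha>\<rfloor> - \<lfloor>y + real r * \<alpha>\<rfloor>)"
      by (simp add: frac_def algebra_simps)
    then have "- real (r + j) * \<alpha> - y \<in> \<int>" by (metis Ints_of_int)
    then have "y = frac (- real (r + j) * \<alpha>)"
      using y(1) frac_unique_iff[of "- real (r + j) * \<alpha>" y] by (simp add: circle_def)
    moreover have "r + j \<in> {r..m}" using y(2) True by (auto simp: r_def)
    ultimately show "y \<in> ?R" by blast
  next
    fix y assume "y \<in> ?R"
    then obtain i where i: "i \<in> {r..m}" "y = frac (- real i * \<alpha>)" by blast
    have "frac (y + real r * \<alpha>) = frac (- real i * \<alpha> + real r * \<alpha>)"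
      unfolding i(2) by (rule frac_add_simps)
    also have "\<dots> = frac (- real (i - r) * \<alpha>)"
      using i(1) by (simp add: of_nat_diff algebra_simps)
    finally show "y \<in> ?L" using i True
      by (auto simp: rotation_funpow D_points_def r_def intro!: image_eqI[of _ _ "i - r"])
  qed
  moreover have "{0..min m (k - 1)} \<union> {r..m} = {j. j \<le> m \<and> (j < k \<or> m < j + k)}"
    using assms True by (auto simp: r_def)
  ultimately show ?thesis
    using True by (simp add: P_points_def D_points_def r_def flip: image_Un)
next
  case False
  then have "{0..min m (k - 1)} = {j. j \<le> m \<and> (j < k \<or> m < j + k)}" by auto
  then show ?thesis using False by (simp add: P_points_def D_points_def)
qed

lemma I_intervals_obtain:
  fixes \<alpha> k m
  defines "P \<equiv> P_points \<alpha> k m"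
  assumes "k \<ge> 1"
  obtains X :: "nat \<Rightarrow> real" and l where
    "I_intervals c \<alpha> k m = {arc c (X i) (X (Suc i)) | i. i < l}"
    "X ` {..<l} = P" "X 0 = 0" "X l = 1" "0 < l"
    "\<And>i j. i \<le> j \<Longrightarrow> j \<le> l \<Longrightarrow> X i \<le> X j"
proof -
  have fin: "finite P" and "0 \<in> P" and bounds: "\<And>p. p \<in> P \<Longrightarrow> 0 \<le> p \<and> p \<le> 1"
    using assms by (auto simp: P_points_eq less_imp_le[OF frac_lt_1] image_iff intro!: exI[of _ 0])
  define s where "s = sorted_list_of_set P"
  have s: "set s = P" "length s = card P" "sorted s"
    using fin by (simp_all add: s_def)
  define X where "X i = (s @ [1]) ! i" for i
  have "0 < card P" using fin \<open>0 \<in> P\<close> by (auto simp: card_gt_0_iff)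
  have sorted: "sorted (s @ [1])" using s bounds by (auto simp: sorted_append)
  have mono: "X i \<le> X j" if "i \<le> j" "j \<le> card P" for i j
    using sorted_nth_mono[OF sorted, of i j] that s by (simp add: X_def)
  have img: "X ` {..<card P} = P"
    using s by (force simp: X_def nth_append set_conv_nth)
  \<comment> \<open>Zero has some index and no point is negative, so monotonicity puts zero
    first.\<close>
  then obtain i where "i < card P" "X i = 0" using \<open>0 \<in> P\<close> by force
  moreover have "X 0 \<in> P" using img \<open>0 < card P\<close> by blast
  ultimately have "X 0 = 0" using mono[of 0 i] bounds[of "X 0"] by simp
  then show thesis
    using that[of X "card P"] img mono \<open>0 < card P\<close> s(2)
    by (simp add: I_intervals_def X_def s_def P_def Let_def nth_append)
qed

lemma I_intervals_cover:
  assumes "k \<ge> 1" "x \<in> circle"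
  obtains J where "J \<in> I_intervals c \<alpha> k m" "x \<in> J"
proof -
  obtain X l where X: "I_intervals c \<alpha> k m = {arc c (X i) (X (Suc i)) | i. i < l}"
    "X ` {..<l} = P_points \<alpha> k m" "X 0 = 0" "X l = 1" "0 < l"
    "\<And>i j. i \<le> j \<Longrightarrow> j \<le> l \<Longrightarrow> X i \<le> X j"
    using I_intervals_obtain[OF assms(1), of c \<alpha> m] by blast
  have bounds: "0 \<le> X i \<and> X i \<le> 1" if "i \<le> l" for i
    using X(6)[of 0 i] X(6)[of i l] X that by simp
  \<comment> \<open>The first interval whose right end \<open>x\<close> has not passed; by
    minimality, or by \<open>X 0 = 0\<close>, its left end has been passed.\<close>
  define i where "i = (LEAST i. step c x (- X (Suc i)) = -1)"
  have last: "step c x (- X (Suc (l - 1))) = -1" using X by simp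
  then have 1: "step c x (- X (Suc i)) = -1" unfolding i_def by (rule LeastI)
  have "i \<le> l - 1" unfolding i_def using last by (rule Least_le)
  then have "i < l" using X(5) by simp
  moreover have "step c x (- X i) = 0"
  proof (cases i)
    case 0
    then show ?thesis using X by simp
  next
    case (Suc i')
    then have "step c x (- X i) \<noteq> -1"
      using not_less_Least[of i' "\<lambda>i. step c x (- X (Suc i)) = -1"] by (simp add: i_def)
    then show ?thesis using step_cases bounds \<open>i < l\<close> by (meson less_imp_le)
  qed
  ultimately have "x \<in> arc c (X i) (X (Suc i))"
    using 1 assms(2) bounds[of i] bounds[of "Suc i"] X(6)[of i "Suc i"] by (simp add: mem_arc_iff)
  then show thesis using that X(1) \<open>i < l\<close> by blast
qed

text \<open>A point of the arc from \<open>X i\<close> to \<open>X (Suc i)\<close> has passed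
  exactly the division points \<open>X j\<close> with \<open>j \<le> i\<close>; conversely, the
  steps at the two ends decide membership.\<close>

lemma I_intervals_mem_iff:
  assumes "k \<ge> 1" "J \<in> I_intervals c \<alpha> k m" "x \<in> J" "y \<in> circle"
  shows "y \<in> J \<longleftrightarrow> (\<forall>p \<in> P_points \<alpha> k m. step c x (-p) = step c y (-p))"
proof -
  obtain X l where X: "I_intervals c \<alpha> k m = {arc c (X i) (X (Suc i)) | i. i < l}"
    "X ` {..<l} = P_points \<alpha> k m" "X 0 = 0" "X l = 1" "0 < l"
    "\<And>i j. i \<le> j \<Longrightarrow> j \<le> l \<Longrightarrow> X i \<le> X j"
    using I_intervals_obtain[OF assms(1), of c \<alpha> m] by blast
  have bounds: "0 \<le> X i \<and> X i \<le> 1" if "i \<le> l" for i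
    using X(6)[of 0 i] X(6)[of i l] X that by simp
  from assms(2) X(1) obtain i where i: "J = arc c (X i) (X (Suc i))" "i < l" by auto
  have mem: "z \<in> J \<longleftrightarrow> z \<in> circle \<and> step c z (- X i) = 0 \<and> step c z (- X (Suc i)) = -1" for z
    using i bounds[of i] bounds[of "Suc i"] X(6)[of i "Suc i"] by (simp add: mem_arc_iff)
  have val: "step c z (- X j) = (if j \<le> i then 0 else -1)" if "z \<in> J" "j < l" for z j
    using that mem[of z] step_cases[of "X j" c z] bounds[of j] i X(6)[of j i] X(6)[of "Suc i" j]
      step_mono[of "- X i" "- X j" c z] step_mono[of "- X j" "- X (Suc i)" c z] by auto
  show ?thesis
  proof
    assume "y \<in> J"
    then show "\<forall>p \<in> P_points \<alpha> k m. step c x (-p) = step c y (-p)"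
      using val assms(3) by (auto simp flip: X(2))
  next
    assume *: "\<forall>p \<in> P_points \<alpha> k m. step c x (-p) = step c y (-p)"
    have "step c x (- X j) = step c y (- X j)" if "j \<le> l" for j
    \<comment> \<open>The closing end \<open>X l = 1\<close> is not a division point, but every
      point has step -1 there.\<close>
    proof (cases "j = l")
      case True
      then show ?thesis by (simp add: X(4))
    next
      case False
      then have "X j \<in> P_points \<alpha> k m" using that X(2) by (metis imageI le_neq_implies_less lessThan_iff)
      then show ?thesis using * by blast
    qed
    then show "y \<in> J" using mem[of x] mem[of y] assms(3,4) i(2) by simp
  qed
qed

theorem theorem3p4:
  fixes \<alpha> :: real and k m :: nat and c :: half_open and u v :: "nat list"
  assumes "\<alpha> \<notin> \<rat>"
    and "k \<ge> 1" and "m \<ge> 1"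
    and "u \<in> sturmian_factors c \<alpha>" and "length u = m"
    and "v \<in> sturmian_factors c \<alpha>" and "length v = m"
  shows "k_abelian_equiv k u v \<longleftrightarrow>
    (\<exists>J \<in> I_intervals c \<alpha> k m. cylinder c \<alpha> u \<subseteq> J \<and> cylinder c \<alpha> v \<subseteq> J)"
proof -
  have \<alpha>: "\<alpha> \<notin> \<int>" using assms(1) Ints_subset_Rats by blast
  have circle: "z \<in> circle" if "z \<in> cylinder c \<alpha> w" for z w
    using that by (simp add: mem_cylinder_iff)
  have equiv: "k_abelian_equiv k w w' \<longleftrightarrow>
      (\<forall>p \<in> P_points \<alpha> k m. step c x (-p) = step c y (-p))"
    if "x \<in> cylinder c \<alpha> w" "y \<in> cylinder c \<alpha> w'" "length w = m" "length w' = m" for x y w w'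
    using k_abelian_equiv_iff_step[OF \<alpha> that assms(2)] step_frac_minus[simplified]
    by (auto simp: P_points_eq[OF assms(2)])
  obtain x where x: "x \<in> cylinder c \<alpha> u" using cylinder_nonempty[OF assms(4)] .
  obtain y where y: "y \<in> cylinder c \<alpha> v" using cylinder_nonempty[OF assms(6)] .
  show ?thesis
  proof
    assume uv: "k_abelian_equiv k u v"
    obtain J where J: "J \<in> I_intervals c \<alpha> k m" "x \<in> J"
      using I_intervals_cover[OF assms(2) circle[OF x]] .
    \<comment> \<open>Reflexivity turns \<open>equiv\<close> into a statement about two points of
      one cylinder, so the whole cylinder of \<open>u\<close> lies in the interval of
      \<open>x\<close>.\<close>
    have "k_abelian_equiv k u u" by (simp add: k_abelian_equiv_def)
    then have "cylinder c \<alpha> u \<subseteq> J" "cylinder c \<alpha> v \<subseteq> J"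
      using I_intervals_mem_iff[OF assms(2) J] circle equiv[OF x] uv assms(5,7) by blast+
    with J show "\<exists>J \<in> I_intervals c \<alpha> k m. cylinder c \<alpha> u \<subseteq> J \<and> cylinder c \<alpha> v \<subseteq> J"
      by blast
  next
    assume "\<exists>J \<in> I_intervals c \<alpha> k m. cylinder c \<alpha> u \<subseteq> J \<and> cylinder c \<alpha> v \<subseteq> J"
    then obtain J where "J \<in> I_intervals c \<alpha> k m" "x \<in> J" "y \<in> J" using x y by blast
    then show "k_abelian_equiv k u v"
      using I_intervals_mem_iff[OF assms(2)] circle[OF y] equiv[OF x y] assms(5,7) by blast
  qed
qed

end
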